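(* Let $M,N\ge 1$, let $u_0\in\mathbb{C}$, and let $\boldsymbol{u}_1,\dots,\boldsymbol{u}_N\in\mathbb{C}^M$ be the exact block solution of the block problem with block propagator $\boldsymbol{\psi}=\boldsymbol{\phi}^{-1}\boldsymbol{\chi}$ (see context). Let $(\boldsymbol{u}^k_n)$ be generated, from arbitrary initial guesses $\boldsymbol{u}^0_1,\dots,\boldsymbol{u}^0_N\in\mathbb{C}^M$, by a primary block iteration $$\boldsymbol{u}^{k+1}_{n+1} = \mathbf{B}^0_1(\boldsymbol{u}^k_{n+1}) + \mathbf{B}^1_0(\boldsymbol{u}^{k+1}_{n}) + \mathbf{B}^0_0(\boldsymbol{u}^{k}_{n}),\qquad \boldsymbol{u}_0^k = u_0\boldsymbol{1}\ \ \forall k\in\mathbb{N},$$ whose linear operators $\mathbf{B}^0_1,\mathbf{B}^1_0,\mathbf{B}^0_0:\mathbb{C}^M\to\mathbb{C}^M$ satisfy the consistency condition $(\mathbf{B}_1^0-\mathbf{I})\boldsymbol{\psi} + \mathbf{B}^1_0 + \mathbf{B}^0_0 = 0$. Fix any norm $\|\cdot\|$ on $\mathbb{C}^M$ with its induced operator norm, and put $$\alpha := \|\mathbf{B}_0^0\|,\quad \beta := \|\mathbf{B}_0^1\|,\quad \gamma := \|\mathbf{B}_1^0\|,\quad e^k_{n}:=\|\boldsymbol{u}^k_{n}-\boldsymbol{u}_{n}\|,\quad \delta := \max_{n=1,\dots,N}\|\boldsymbol{u}^0_n-\boldsymbol{u}_n\|.$$ Then for all integers $k>0$ and $0\le n\le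 N-1$, $$e^k_{n+1} \le \theta_{n+1}^k(\alpha,\beta,\gamma)\,\delta,$$ where $\theta_{n+1}^k$ is defined as follows: (i) if only $\gamma=0$ (that is, $\gamma=0$, $\alpha\ne0$, $\beta\neq 0$), then $$\theta_{n+1}^k = \frac{\alpha^k}{(k-1)!}\sum_{i=0}^{n-k}\ \prod_{l=1}^{k-1}(i+l)\,\beta^{i};$$ (ii) if only $\beta=0$ (that is, $\beta=0$, $\alpha\neq0$, $\gamma\ne0$), then $$\theta_{n+1}^k = \begin{cases}(\gamma+\alpha)^k & \text{if } k\le n,\\[2pt] \displaystyle\gamma^k\sum_{i=0}^{n}\binom{k}{i}\left(\frac{\alpha}{\gamma}\right)^i & \text{otherwise;}\end{cases}$$ (iii) if only $\alpha=0$ (that is, $\alpha=0$, $\beta\ne0$, $\gamma\neq 0$), then $$\theta_{n+1}^k = \frac{\gamma^k}{(k-1)!}\sum_{i=0}^{n}\ \prod_{l=1}^{k-1}(i+l)\,\beta^{i};$$ (iv) if none of $\alpha,\beta,\gamma$ is zero, then $$\theta_{n+1}^k = \gamma^k\sum_{i=0}^{\min(n,k)}\ \sum_{l=0}^{n-i}\binom{k}{i}\binom{l+k-1}{l}\left(\frac{\alpha}{\gamma}\right)^i\beta^l.$$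
   Context: Block problem: $\boldsymbol{\phi},\boldsymbol{\chi}:\mathbb{C}^M\to\mathbb{C}^M$ are linear maps (block operators) with $\boldsymbol{\phi}$ bijective, arising from a numerical discretization of the Dahlquist equation $u'=\lambda u$, $u(0)=u_0$, $\lambda\in\mathbb{C}$, over $N$ consecutive time sub-intervals with $M$ grid points each. The exact block solution is defined by $\boldsymbol{\phi}(\boldsymbol{u}_1)=\boldsymbol{\chi}(u_0\boldsymbol{1})$ and $\boldsymbol{\phi}(\boldsymbol{u}_{n+1})=\boldsymbol{\chi}(\boldsymbol{u}_n)$ for $n=1,\dots,N-1$, where $\boldsymbol{1}=[1,\dots,1]^T\in\mathbb{C}^M$. The time propagator is $\boldsymbol{\psi}:=\boldsymbol{\phi}^{-1}\boldsymbol{\chi}$, so $\boldsymbol{u}_{n+1}=\boldsymbol{\psi}\boldsymbol{u}_n$ for $n\ge 0$ with the convention that the zeroth block is $u_0\boldsymbol{1}$. In the operators $\mathbf{B}^j_i$, the upper index is the shift in the iteration index $k$ and the lower index is the shift in the block index $n$ of the block variable acted upon. $\mathbf{I}$ is the identity. Conventions: an empty product equals $1$ and an empty sum equals $0$ (so in case (i) the bound is $0$ when $n<k$). *)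

theory Defs
  imports "HOL-Analysis.Analysis"
begin

text \<open>
  Block variables live in \<open>complex ^ 'm\<close>, the number of grid points per block being
  \<open>CARD('m)\<close>; \<open>1 :: complex ^ 'm\<close> is the vector with all entries one.
\<close>

abbreviation clinear_op :: "(complex ^ 'm \<Rightarrow> complex ^ 'm) \<Rightarrow> bool" where
  "clinear_op \<equiv> Vector_Spaces.linear (*s) (*s)"

definition is_cnorm :: "(complex ^ 'm \<Rightarrow> real) \<Rightarrow> bool" where
  "is_cnorm nrm \<longleftrightarrow>
     (\<forall>x. 0 \<le> nrm x) \<and>
     (\<forall>x. nrm x = 0 \<longleftrightarrow> x = 0) \<and>
     (\<forall>c x. nrm (c *s x) = cmod c * nrm x) \<and>
     (\<forall>x y. nrm (x + y) \<le> nrm x + nrm y)"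

text \<open>
  The operator norm induced by an arbitrary norm; \<^const>\<open>onorm\<close> is tied to the norm of the
  type class. As there, the vector \<open>x = 0\<close> contributes the value \<open>0 / 0 = 0\<close>.
\<close>
definition induced_norm ::
    "(complex ^ 'm \<Rightarrow> real) \<Rightarrow> (complex ^ 'm \<Rightarrow> complex ^ 'm) \<Rightarrow> real" where
  "induced_norm nrm A = (SUP x. nrm (A x) / nrm x)"

definition block_propagator ::
    "(complex ^ 'm \<Rightarrow> complex ^ 'm) \<Rightarrow> (complex ^ 'm \<Rightarrow> complex ^ 'm) \<Rightarrow>
     complex ^ 'm \<Rightarrow> complex ^ 'm" where
  "block_propagator phi chi = inv phi \<circ> chi"

definition exact_block_solution ::
    "(complex ^ 'm \<Rightarrow> complex ^ 'm) \<Rightarrow> (complex ^ 'm \<Rightarrow> complex ^ 'm) \<Rightarrow>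
     complex \<Rightarrow> nat \<Rightarrow> (nat \<Rightarrow> complex ^ 'm) \<Rightarrow> bool" where
  "exact_block_solution phi chi u0 N u \<longleftrightarrow>
     phi (u 1) = chi (u0 *s 1) \<and>
     (\<forall>n \<in> {1..<N}. phi (u (n + 1)) = chi (u n))"

text \<open>
  \<open>U k n\<close> is the iterate with iteration index \<open>k\<close> and block index \<open>n\<close>. The initial
  guesses \<open>U 0 1, \<dots>, U 0 N\<close> are unconstrained.
\<close>
definition primary_block_iteration ::
    "(complex ^ 'm \<Rightarrow> complex ^ 'm) \<Rightarrow> (complex ^ 'm \<Rightarrow> complex ^ 'm) \<Rightarrow>
     (complex ^ 'm \<Rightarrow> complex ^ 'm) \<Rightarrow> complex \<Rightarrow> nat \<Rightarrow> (nat \<Rightarrow> nat \<Rightarrow> complex ^ 'm) \<Rightarrow> bool" where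
  "primary_block_iteration B01 B10 B00 u0 N U \<longleftrightarrow>
     (\<forall>k. U k 0 = u0 *s 1) \<and>
     (\<forall>k. \<forall>n<N. U (k + 1) (n + 1) = B01 (U k (n + 1)) + B10 (U (k + 1) n) + B00 (U k n))"

end

theory Submission
  imports Defs "HOL-Computational_Algebra.Formal_Power_Series"
begin

text \<open>
  By consistency the errors satisfy
  \<open>e\<^bsub>n+1\<^esub> (k+1) \<le> \<gamma> e\<^bsub>n+1\<^esub> k + \<beta> e\<^bsub>n\<^esub> (k+1) + \<alpha> e\<^bsub>n\<^esub> k\<close>, with zero
  error in block \<open>0\<close>. The generating functions in the block index of the extremal solutions obey
  \<open>(1 - \<beta> X) \<rho>\<^bsub>k+1\<^esub> = (\<gamma> + \<alpha> X) \<rho>\<^bsub>k\<^esub>\<close> with \<open>\<rho>\<^bsub>0\<^esub> = \<delta> / (1 - X)\<close>, hence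
  \<open>\<rho>\<^bsub>k\<^esub> = \<delta> ((\<gamma> + \<alpha> X) / (1 - \<beta> X))\<^sup>k / (1 - X)\<close>; its coefficients, computed by the
  binomial theorem and the negative binomial series, are the stated bounds.
\<close>

section \<open>Norms on complex vectors\<close>

lemma scaleR_eq_of_real_smult: "r *\<^sub>R x = complex_of_real r *s x" for x :: "complex ^ 'm"
  unfolding vec_eq_iff vector_scaleR_component vector_smult_component
  by (simp add: scaleR_conv_of_real)

text \<open>Complex linearity restricts to real linearity, and a real-linear map on a
  finite-dimensional space is bounded.\<close>

lemma clinear_op_imp_bounded_linear:
  fixes A :: "complex ^ 'm \<Rightarrow> complex ^ 'm"
  assumes "clinear_op A"
  shows "bounded_linear A"
proof -
  interpret A: Vector_Spaces.linear "(*s)" "(*s)" A by fact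
  have "linear A"
    by (intro linearI) (simp_all only: scaleR_eq_of_real_smult A.add A.scale)
  then show ?thesis
    by (rule linear_conv_bounded_linear[THEN iffD1])
qed

context
  fixes nrm :: "complex ^ 'm \<Rightarrow> real"
  assumes cnorm: "is_cnorm nrm"
begin

lemma cnorm_nonneg: "0 \<le> nrm x"
  and cnorm_eq_0_iff: "nrm x = 0 \<longleftrightarrow> x = 0"
  and cnorm_scale: "nrm (c *s x) = cmod c * nrm x"
  and cnorm_triangle: "nrm (x + y) \<le> nrm x + nrm y"
  using cnorm unfolding is_cnorm_def by auto

lemma cnorm_minus: "nrm (- x) = nrm x"
  using cnorm_scale[of "-1" x] by simp

lemma cnorm_scaleR: "nrm (r *\<^sub>R x) = \<bar>r\<bar> * nrm x"
  by (simp add: scaleR_eq_of_real_smult cnorm_scale)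

lemma cnorm_sum: "finite I \<Longrightarrow> nrm (\<Sum>i\<in>I. f i) \<le> (\<Sum>i\<in>I. nrm (f i))"
proof (induction rule: finite_induct)
  case empty
  then show ?case using cnorm_eq_0_iff[of 0] by simp
next
  case (insert i I)
  then show ?case using cnorm_triangle[of "f i" "\<Sum>i\<in>I. f i"] by simp
qed

text \<open>First half of the equivalence of \<open>nrm\<close> with the Euclidean norm: expand in
  the standard basis and bound each coordinate by \<open>norm x\<close>.\<close>

lemma cnorm_le_norm:
  obtains C where "C > 0" "\<And>x. nrm x \<le> C * norm x"
proof
  \<comment> \<open>The summand 1 makes the constant positive without inspecting the basis
    vectors.\<close>
  let ?C = "1 + (\<Sum>i\<in>UNIV. nrm (axis i 1))"
  show "?C > 0" by (simp add: add_pos_nonneg sum_nonneg cnorm_nonneg)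
  show "nrm x \<le> ?C * norm x" for x
  proof -
    have "nrm x = nrm (\<Sum>i\<in>UNIV. x $ i *s axis i 1)"
      by (simp add: basis_expansion)
    also have "\<dots> \<le> (\<Sum>i\<in>UNIV. nrm (x $ i *s axis i 1))"
      by (rule cnorm_sum) simp
    also have "\<dots> \<le> (\<Sum>i\<in>UNIV. norm x * nrm (axis i 1))"
      unfolding cnorm_scale
      by (intro sum_mono mult_right_mono Finite_Cartesian_Product.norm_nth_le cnorm_nonneg)
    also have "\<dots> \<le> ?C * norm x"
      by (simp add: sum_distrib_left algebra_simps)
    finally show ?thesis .
  qed
qed

text \<open>Second half of the equivalence. By the first half \<open>nrm\<close> is Lipschitz, so it
  attains a minimum on the compact unit sphere; definiteness makes this minimum positive, and
  scaling extends the bound to all vectors.\<close>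

lemma norm_le_cnorm:
  obtains C where "C > 0" "\<And>x. norm x \<le> C * nrm x"
proof -
  obtain K where K: "K > 0" "\<And>x. nrm x \<le> K * norm x" using cnorm_le_norm by blast
  have "\<bar>nrm x - nrm y\<bar> \<le> K * norm (x - y)" for x y
    using cnorm_triangle[of "x - y" y] cnorm_triangle[of "y - x" x] cnorm_minus[of "x - y"]
      K(2)[of "x - y"] by simp
  then have "K-lipschitz_on UNIV nrm"
    using K(1) by (intro lipschitz_onI) (auto simp: dist_norm)
  then have "continuous_on UNIV nrm"
    by (rule lipschitz_on_continuous_on)
  then have cont: "continuous_on (sphere 0 1) nrm"
    by (rule continuous_on_subset) simp
  have "sphere 0 1 \<noteq> ({} :: (complex ^ 'm) set)" by simp
  then obtain z where z: "z \<in> sphere 0 1" "\<And>x. x \<in> sphere 0 1 \<Longrightarrow> nrm z \<le> nrm x"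
    using continuous_attains_inf[OF compact_sphere _ cont] by blast
  have zpos: "nrm z > 0"
    using z(1) cnorm_nonneg[of z] cnorm_eq_0_iff[of z] by force
  have "norm x \<le> inverse (nrm z) * nrm x" for x
  proof (cases "x = 0")
    case True
    then show ?thesis by (simp add: cnorm_nonneg zpos less_imp_le)
  next
    case False
    then have "nrm z \<le> nrm (inverse (norm x) *\<^sub>R x)" by (intro z(2)) simp
    then show ?thesis using False zpos by (simp add: cnorm_scaleR field_simps)
  qed
  with that[of "inverse (nrm z)"] zpos show ?thesis by simp
qed

text \<open>A real \<open>SUP\<close> bounds its members only if the set is bounded above.
  Equivalence of norms transfers this from Euclidean boundedness of \<open>A\<close>.\<close>

lemma bdd_above_cnorm_quotient:
  assumes "clinear_op A"
  shows "bdd_above (range (\<lambda>x. nrm (A x) / nrm x))"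
proof -
  obtain K where K: "K > 0" "\<And>x. nrm x \<le> K * norm x" using cnorm_le_norm by blast
  obtain L where L: "L > 0" "\<And>x. norm x \<le> L * nrm x" using norm_le_cnorm by blast
  obtain P where P: "P > 0" "\<And>x. norm (A x) \<le> norm x * P"
    using bounded_linear.pos_bounded[OF clinear_op_imp_bounded_linear[OF assms]] by blast
  have "nrm (A x) / nrm x \<le> K * (L * P)" for x
  proof (cases "x = 0")
    case True
    then show ?thesis using K(1) L(1) P(1) cnorm_eq_0_iff[of 0] by simp
  next
    case False
    then have pos: "nrm x > 0" using cnorm_nonneg[of x] cnorm_eq_0_iff[of x] by simp
    have "nrm (A x) \<le> K * (norm x * P)"
      using K(2)[of "A x"] mult_left_mono[OF P(2)[of x], of K] K(1) by linarith
    also have "\<dots> \<le> K * (L * nrm x * P)"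
      using L(2)[of x] K(1) P(1) by (intro mult_left_mono mult_right_mono) auto
    finally show ?thesis using pos by (simp add: field_simps)
  qed
  then show ?thesis by (intro bdd_aboveI2)
qed

lemma induced_norm_nonneg:
  assumes "clinear_op A"
  shows "0 \<le> induced_norm nrm A"
proof -
  \<comment> \<open>The quotient at the zero vector is 0 / 0 = 0, so the supremum dominates
    0.\<close>
  have "nrm (A 0) / nrm 0 \<le> induced_norm nrm A"
    unfolding induced_norm_def by (rule cSUP_upper[OF UNIV_I bdd_above_cnorm_quotient[OF assms]])
  then show ?thesis using cnorm_eq_0_iff[of 0] by simp
qed

lemma cnorm_le_induced_norm:
  assumes "clinear_op A"
  shows "nrm (A x) \<le> induced_norm nrm A * nrm x"
proof (cases "x = 0")
  case True
  interpret A: Vector_Spaces.linear "(*s)" "(*s)" A by fact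
  from True show ?thesis by (simp add: A.zero cnorm_eq_0_iff[of 0, simplified])
next
  case False
  then have pos: "nrm x > 0" using cnorm_nonneg[of x] cnorm_eq_0_iff[of x] by simp
  have "nrm (A x) / nrm x \<le> induced_norm nrm A"
    unfolding induced_norm_def by (rule cSUP_upper[OF UNIV_I bdd_above_cnorm_quotient[OF assms]])
  with pos show ?thesis by (simp add: field_simps)
qed

end

section \<open>The extremal solutions of the error recurrence\<close>

unbundle no vec_syntax
unbundle fps_syntax

text \<open>This is the series of (1 - b X)^(-k), given by coefficients so that no division is
  required. Truncated subtraction makes k = 0 come out right: the coefficient is 1 at l = 0, and (l
  - 1) choose l = 0 for l > 0.\<close>

definition neg_binomial_fps :: "'a::comm_ring_1 \<Rightarrow> nat \<Rightarrow> 'a fps" where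
  "neg_binomial_fps b k = Abs_fps (\<lambda>l. of_nat ((l + k - 1) choose l) * b ^ l)"

lemma neg_binomial_fps_0: "neg_binomial_fps b 0 = 1"
  by (rule fps_ext) (simp add: neg_binomial_fps_def binomial_eq_0)

text \<open>Coefficientwise this is Pascal's rule.\<close>

lemma neg_binomial_fps_Suc:
  "neg_binomial_fps b (Suc k) * (1 - fps_const b * fps_X) = neg_binomial_fps b k"
proof -
  have "neg_binomial_fps b (Suc k) - fps_const b * neg_binomial_fps b (Suc k) * fps_X
      = neg_binomial_fps b k"
  proof (rule fps_ext)
    fix n
    show "(neg_binomial_fps b (Suc k) - fps_const b * neg_binomial_fps b (Suc k) * fps_X) $ n
        = neg_binomial_fps b k $ n"
      by (cases n) (simp_all add: neg_binomial_fps_def algebra_simps)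
  qed
  then show ?thesis by (simp add: algebra_simps)
qed

lemma linear_fps_power_nth:
  "((fps_const c + fps_const a * fps_X) ^ k) $ i
     = (of_nat (k choose i) * c ^ (k - i) * a ^ i :: 'a::comm_ring_1)"
proof -
  have "((fps_const c + fps_const a * fps_X) ^ k) $ i
      = (\<Sum>j\<le>k. (of_nat (k choose j) * (fps_const a * fps_X) ^ j * fps_const c ^ (k - j)) $ i)"
    by (subst add.commute) (simp add: binomial_ring fps_sum_nth)
  also have "\<dots> = (\<Sum>j\<le>k. if i = j then of_nat (k choose j) * c ^ (k - j) * a ^ j else 0)"
  proof (rule sum.cong)
    fix j
    have "of_nat (k choose j) * (fps_const a * fps_X) ^ j * fps_const c ^ (k - j)
        = fps_const (of_nat (k choose j) * c ^ (k - j) * a ^ j) * fps_X ^ j"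
      by (simp add: power_mult_distrib fps_const_power fps_of_nat[symmetric] mult_ac
          flip: fps_const_mult)
    then show "(of_nat (k choose j) * (fps_const a * fps_X) ^ j * fps_const c ^ (k - j)) $ i
        = (if i = j then of_nat (k choose j) * c ^ (k - j) * a ^ j else 0)"
      by (simp add: fps_X_power_nth)
  qed simp
  also have "\<dots> = of_nat (k choose i) * c ^ (k - i) * a ^ i"
    by (simp add: binomial_eq_0)
  finally show ?thesis .
qed

text \<open>The last factor is 1 / (1 - X), encoding the same initial bound on every block; the
  factor \<open>d\<close> is left out. Coefficient n belongs to block n + 1, since block 0 carries
  no error.\<close>

definition error_gf :: "'a::comm_ring_1 \<Rightarrow> 'a \<Rightarrow> 'a \<Rightarrow> nat \<Rightarrow> 'a fps" where
  "error_gf a b c k =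
     (fps_const c + fps_const a * fps_X) ^ k * (neg_binomial_fps b k * Abs_fps (\<lambda>_. 1))"

lemma error_gf_0_nth: "error_gf a b c 0 $ n = 1"
  by (simp add: error_gf_def neg_binomial_fps_0)

lemma error_gf_Suc:
  "error_gf a b c (Suc k) * (1 - fps_const b * fps_X)
     = error_gf a b c k * (fps_const c + fps_const a * fps_X)"
  unfolding error_gf_def neg_binomial_fps_Suc[of b k, symmetric] by (simp add: mult_ac)

lemma error_gf_Suc_nth_0: "error_gf a b c (Suc k) $ 0 = c * error_gf a b c k $ 0"
  using arg_cong[OF error_gf_Suc[of a b c k], of "\<lambda>f. f $ 0"] by (simp add: mult.commute)

text \<open>Comparing coefficients in the functional equation gives the error recurrence with
  equality.\<close>

lemma error_gf_Suc_nth_Suc: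
  "error_gf a b c (Suc k) $ Suc n =
     c * error_gf a b c k $ Suc n + b * error_gf a b c (Suc k) $ n + a * error_gf a b c k $ n"
proof -
  have "error_gf a b c (Suc k) - fps_const b * error_gf a b c (Suc k) * fps_X
      = fps_const c * error_gf a b c k + fps_const a * error_gf a b c k * fps_X"
    using error_gf_Suc[of a b c k] by (simp add: algebra_simps)
  from arg_cong[OF this, of "\<lambda>f. f $ Suc n"] show ?thesis
    by (simp add: algebra_simps)
qed

text \<open>Cauchy product, where the factor 1 / (1 - X) turns the coefficients of the negative
  binomial series into partial sums.\<close>

lemma error_gf_nth:
  "error_gf a b c k $ n = (\<Sum>i=0..n. of_nat (k choose i) * c ^ (k - i) * a ^ i
      * (\<Sum>l=0..n - i. of_nat ((l + k - 1) choose l) * b ^ l))"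
  by (simp add: error_gf_def fps_mult_nth linear_fps_power_nth neg_binomial_fps_def)

section \<open>Closed forms of the coefficients in the four cases\<close>

lemma rising_product_eq_binomial:
  fixes k :: nat
  assumes "k > 0"
  shows "(\<Prod>l=1..k - 1. real (i + l)) = fact (k - 1) * real ((i + k - 1) choose i)"
proof -
  obtain m where k: "k = Suc m" using assms gr0_implies_Suc by blast
  \<comment> \<open>Both sides of the claim equal (i + m)! / i!, so they are compared after
    multiplication by \<open>fact i\<close>.\<close>
  have "fact i * (\<Prod>l=1..m. real (i + l)) = fact (i + m)"
  proof (induction m)
    case (Suc m)
    have "fact i * (\<Prod>l=1..Suc m. real (i + l))
        = fact i * (\<Prod>l=1..m. real (i + l)) * real (i + Suc m)"
      by simp
    then show ?case unfolding Suc.IH by simp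
  qed simp
  moreover have "fact i * fact m * real ((i + m) choose i) = fact (i + m)"
    using binomial_fact_lemma[of i "i + m"]
    by (metis add_diff_cancel_left' le_add1 of_nat_fact of_nat_mult)
  ultimately have "fact i * (\<Prod>l=1..m. real (i + l)) = fact i * (fact m * real ((i + m) choose i))"
    by (simp add: mult.assoc)
  then show ?thesis by (simp add: k)
qed

lemma rising_product_sum:
  fixes b :: real
  assumes "k > 0"
  shows "(\<Sum>i\<in>I. (\<Prod>l=1..k - 1. real (i + l)) * b ^ i)
    = fact (k - 1) * (\<Sum>i\<in>I. real ((i + k - 1) choose i) * b ^ i)"
  unfolding sum_distrib_left
  by (intro sum.cong refl) (simp only: rising_product_eq_binomial[OF assms] mult.assoc)

text \<open>With c = 0 the linear factor is the monomial a^k X^k, which shifts the index by k. The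
  set \<open>{i. i + k \<le> n}\<close> is empty for n < k, whereas \<open>{0..n - k}\<close> would
  then still contain 0.\<close>

lemma error_gf_nth_c_0:
  fixes a b :: real
  assumes "k > 0"
  shows "error_gf a b 0 k $ n
    = a ^ k / fact (k - 1) * (\<Sum>i | i + k \<le> n. (\<Prod>l=1..k - 1. real (i + l)) * b ^ i)"
proof -
  let ?S = "\<lambda>i. \<Sum>l=0..n - i. real ((l + k - 1) choose l) * b ^ l"
  have "error_gf a b 0 k $ n = (\<Sum>i=0..n. if i = k then a ^ k * ?S k else 0)"
    unfolding error_gf_nth
  proof (rule sum.cong)
    fix i
    show "real (k choose i) * 0 ^ (k - i) * a ^ i * ?S i = (if i = k then a ^ k * ?S k else 0)"
      \<comment> \<open>For i < k the power of 0 vanishes; for i > k that power is 0^0 = 1, but the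
        binomial coefficient vanishes.\<close>
      by (cases i k rule: linorder_cases) (auto simp: binomial_eq_0)
  qed simp
  also have "\<dots> = (if k \<le> n then a ^ k * ?S k else 0)"
    by simp
  also have "\<dots> = a ^ k * (\<Sum>i | i + k \<le> n. real ((i + k - 1) choose i) * b ^ i)"
  proof (cases "k \<le> n")
    case True
    then have "{i. i + k \<le> n} = {0..n - k}" by auto
    with True show ?thesis by simp
  next
    case False
    then have "{i. i + k \<le> n} = {}" by auto
    with False show ?thesis by simp
  qed
  finally show ?thesis
    by (simp only: rising_product_sum[OF assms]) simp
qed

text \<open>The inner sum collapses to its term l = 0, leaving the binomial expansion of (c + a)^k
  cut off after index n; it is complete exactly when k \<le> n is assumed.\<close>

lemma error_gf_nth_b_0:
  fixes a c :: real
  assumes "c \<noteq> 0"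
  shows "error_gf a 0 c k $ n = (if k \<le> n then (c + a) ^ k
    else c ^ k * (\<Sum>i=0..n. real (k choose i) * (a / c) ^ i))"
proof -
  have "(\<Sum>l=0..m. real ((l + k - 1) choose l) * 0 ^ l) = (1::real)" for m
    by (simp add: sum.atLeast_Suc_atMost power_0_left)
  then have coeff: "error_gf a 0 c k $ n = (\<Sum>i=0..n. real (k choose i) * c ^ (k - i) * a ^ i)"
    by (simp add: error_gf_nth)
  show ?thesis
  proof (cases "k \<le> n")
    case True
    then have "error_gf a 0 c k $ n = (\<Sum>i\<le>k. real (k choose i) * a ^ i * c ^ (k - i))"
      unfolding coeff by (intro sum.mono_neutral_cong_right) (auto simp: binomial_eq_0)
    with True show ?thesis by (simp add: add.commute[of c] binomial_ring)
  next
    case False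
    then show ?thesis
      unfolding coeff sum_distrib_left using assms
      by (auto intro!: sum.cong simp: power_diff power_divide)
  qed
qed

lemma error_gf_nth_a_0:
  fixes b c :: real
  assumes "k > 0"
  shows "error_gf 0 b c k $ n
    = c ^ k / fact (k - 1) * (\<Sum>i=0..n. (\<Prod>l=1..k - 1. real (i + l)) * b ^ i)"
proof -
  have "error_gf 0 b c k $ n = c ^ k * (\<Sum>i=0..n. real ((i + k - 1) choose i) * b ^ i)"
    by (simp add: error_gf_nth sum.atLeast_Suc_atMost power_0_left)
  then show ?thesis
    by (simp only: rising_product_sum[OF assms]) simp
qed

text \<open>Terms with i > k vanish; for i \<le> k the power c^(k - i) is a true quotient c^k /
  c^i.\<close>

lemma error_gf_nth_c_nonzero:
  fixes a b c :: real
  assumes "c \<noteq> 0"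
  shows "error_gf a b c k $ n = c ^ k * (\<Sum>i=0..min n k. \<Sum>l=0..n - i.
    real (k choose i) * real ((l + k - 1) choose l) * (a / c) ^ i * b ^ l)"
proof -
  have "error_gf a b c k $ n = (\<Sum>i=0..min n k. real (k choose i) * c ^ (k - i) * a ^ i
      * (\<Sum>l=0..n - i. real ((l + k - 1) choose l) * b ^ l))"
    unfolding error_gf_nth by (rule sum.mono_neutral_right) (auto simp: binomial_eq_0)
  also have "\<dots> = (\<Sum>i=0..min n k. c ^ k * (\<Sum>l=0..n - i.
      real (k choose i) * real ((l + k - 1) choose l) * (a / c) ^ i * b ^ l))"
    unfolding sum_distrib_left using assms
    by (intro sum.cong refl) (simp add: power_diff power_divide)
  finally show ?thesis by (simp add: sum_distrib_left)
qed

section \<open>Comparison with the extremal solution\<close>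

lemma error_recurrence_bound:
  fixes a b c d :: real and e :: "nat \<Rightarrow> nat \<Rightarrow> real"
  assumes nonneg: "a \<ge> 0" "b \<ge> 0" "c \<ge> 0"
    and init: "\<And>n. n < N \<Longrightarrow> e 0 (Suc n) \<le> d"
    and boundary: "\<And>k. e k 0 = 0"
    and step: "\<And>k n. n < N \<Longrightarrow>
      e (Suc k) (Suc n) \<le> c * e k (Suc n) + b * e (Suc k) n + a * e k n"
    and "n < N"
  shows "e k (Suc n) \<le> error_gf a b c k $ n * d"
  using \<open>n < N\<close>
proof (induction k arbitrary: n)
  case 0
  then show ?case by (simp add: init error_gf_0_nth)
next
  case (Suc k)
  \<comment> \<open>The bound for iteration k on all blocks is saved before the inner induction on
    the block index, which shadows the name.\<close>
  note IH = Suc.IH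
  show ?case
    using Suc.prems
  proof (induction n)
    case 0
    \<comment> \<open>Both terms from block 0 drop out by the boundary condition.\<close>
    have "e (Suc k) (Suc 0) \<le> c * e k (Suc 0)"
      using step[OF 0, of k] by (simp add: boundary)
    also have "\<dots> \<le> c * (error_gf a b c k $ 0 * d)"
      using IH[OF 0] nonneg by (intro mult_left_mono)
    finally show ?case by (simp add: error_gf_Suc_nth_0)
  next
    case (Suc n)
    then have "n < N" by simp
    have "e (Suc k) (Suc (Suc n))
        \<le> c * e k (Suc (Suc n)) + b * e (Suc k) (Suc n) + a * e k (Suc n)"
      using Suc.prems by (rule step)
    also have "\<dots> \<le> c * (error_gf a b c k $ Suc n * d) + b * (error_gf a b c (Suc k) $ n * d)
        + a * (error_gf a b c k $ n * d)"
      using IH[OF Suc.prems] IH[OF \<open>n < N\<close>] Suc.IH[OF \<open>n < N\<close>] nonneg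
      by (intro add_mono mult_left_mono)
    also have "\<dots> = error_gf a b c (Suc k) $ Suc n * d"
      by (simp add: error_gf_Suc_nth_Suc algebra_simps)
    finally show ?case .
  qed
qed

section \<open>The error bounds\<close>

theorem theorem2p8:
  fixes phi chi B01 B10 B00 :: "complex ^ 'm \<Rightarrow> complex ^ 'm"
    and u0 :: complex and N :: nat
    and u :: "nat \<Rightarrow> complex ^ 'm" and U :: "nat \<Rightarrow> nat \<Rightarrow> complex ^ 'm"
    and nrm :: "complex ^ 'm \<Rightarrow> real"
    and \<alpha> \<beta> \<gamma> \<delta> :: real and e :: "nat \<Rightarrow> nat \<Rightarrow> real"
  assumes "N \<ge> 1"
    and "clinear_op phi" and "bij phi" and "clinear_op chi"
    and "exact_block_solution phi chi u0 N u"
    and "clinear_op B01" and "clinear_op B10" and "clinear_op B00"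
    and "primary_block_iteration B01 B10 B00 u0 N U"
    and consistency: "\<forall>v. (B01 (block_propagator phi chi v) - block_propagator phi chi v)
                            + B10 v + B00 v = 0"
    and "is_cnorm nrm"
  defines "\<alpha> \<equiv> induced_norm nrm B00"
    and "\<beta> \<equiv> induced_norm nrm B10"
    and "\<gamma> \<equiv> induced_norm nrm B01"
    and "e \<equiv> \<lambda>k n. nrm (U k n - u n)"
    and "\<delta> \<equiv> Max ((\<lambda>n. nrm (U 0 n - u n)) ` {1..N})"
  shows "\<forall>k n. k > 0 \<and> n \<le> N - 1 \<longrightarrow>
     (\<gamma> = 0 \<and> \<alpha> \<noteq> 0 \<and> \<beta> \<noteq> 0 \<longrightarrow>
        e k (n + 1) \<le> (\<alpha> ^ k / fact (k - 1)
          * (\<Sum>i | i + k \<le> n. (\<Prod>l = 1..k - 1. real (i + l)) * \<beta> ^ i)) * \<delta>) \<and>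
     (\<beta> = 0 \<and> \<alpha> \<noteq> 0 \<and> \<gamma> \<noteq> 0 \<longrightarrow>
        e k (n + 1) \<le> (if k \<le> n then (\<gamma> + \<alpha>) ^ k
          else \<gamma> ^ k * (\<Sum>i = 0..n. real (k choose i) * (\<alpha> / \<gamma>) ^ i)) * \<delta>) \<and>
     (\<alpha> = 0 \<and> \<beta> \<noteq> 0 \<and> \<gamma> \<noteq> 0 \<longrightarrow>
        e k (n + 1) \<le> (\<gamma> ^ k / fact (k - 1)
          * (\<Sum>i = 0..n. (\<Prod>l = 1..k - 1. real (i + l)) * \<beta> ^ i)) * \<delta>) \<and>
     (\<alpha> \<noteq> 0 \<and> \<beta> \<noteq> 0 \<and> \<gamma> \<noteq> 0 \<longrightarrow>
        e k (n + 1) \<le> (\<gamma> ^ k * (\<Sum>i = 0..min n k. \<Sum>l = 0..n - i.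
            real (k choose i) * real ((l + k - 1) choose l) * (\<alpha> / \<gamma>) ^ i * \<beta> ^ l)) * \<delta>)"
proof -
  note lin = \<open>clinear_op B01\<close> \<open>clinear_op B10\<close> \<open>clinear_op B00\<close>
  note nrm = \<open>is_cnorm nrm\<close>
  interpret B01: Vector_Spaces.linear "(*s)" "(*s)" B01 by fact
  interpret B10: Vector_Spaces.linear "(*s)" "(*s)" B10 by fact
  interpret B00: Vector_Spaces.linear "(*s)" "(*s)" B00 by fact
  \<comment> \<open>The value \<open>u 0\<close> is unconstrained; the zeroth block is put there by hand.\<close>
  define v where "v = u(0 := u0 *s 1)"
  define err where "err k n = U k n - v n" for k n
  have v_Suc: "block_propagator phi chi (v n) = v (Suc n)" if "n < N" for n
  proof -
    have "phi (v (Suc n)) = chi (v n)"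
      using \<open>exact_block_solution phi chi u0 N u\<close> that
      by (cases n) (auto simp: exact_block_solution_def v_def)
    then show ?thesis
      using \<open>bij phi\<close> by (metis block_propagator_def bij_inv_eq_iff comp_apply)
  qed
  have err_Suc: "err (Suc k) (Suc n) = B01 (err k (Suc n)) + B10 (err (Suc k) n) + B00 (err k n)"
    if "n < N" for k n
  proof -
    have "U (Suc k) (Suc n) = B01 (U k (Suc n)) + B10 (U (Suc k) n) + B00 (U k n)"
      using \<open>primary_block_iteration B01 B10 B00 u0 N U\<close> that
      by (simp add: primary_block_iteration_def)
    \<comment> \<open>Consistency says that the exact solution is a fixed point of the iteration;
      subtracting it leaves the same recurrence for the errors.\<close>
    moreover have "v (Suc n) = B01 (v (Suc n)) + B10 (v n) + B00 (v n)"
      using consistency[rule_format, of "v n"] v_Suc[OF that] by (simp add: algebra_simps)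
    ultimately show ?thesis
      unfolding err_def B01.diff B10.diff B00.diff by (metis (no_types) add_diff_add)
  qed
  have nonneg: "\<alpha> \<ge> 0" "\<beta> \<ge> 0" "\<gamma> \<ge> 0"
    unfolding \<alpha>_def \<beta>_def \<gamma>_def by (rule induced_norm_nonneg[OF nrm] lin)+
  have bound: "nrm (err k (Suc n)) \<le> error_gf \<alpha> \<beta> \<gamma> k $ n * \<delta>" if "n < N" for k n
  proof (rule error_recurrence_bound[where e = "\<lambda>k n. nrm (err k n)" and N = N, OF nonneg _ _ _ that])
    show "nrm (err 0 (Suc n)) \<le> \<delta>" if "n < N" for n
      unfolding \<delta>_def using that by (intro Max_ge) (auto simp: err_def v_def)
    show "nrm (err k 0) = 0" for k
      using \<open>primary_block_iteration B01 B10 B00 u0 N U\<close> cnorm_eq_0_iff[OF nrm]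
      by (simp add: primary_block_iteration_def err_def v_def)
    show "nrm (err (Suc k) (Suc n))
        \<le> \<gamma> * nrm (err k (Suc n)) + \<beta> * nrm (err (Suc k) n) + \<alpha> * nrm (err k n)"
      if "n < N" for k n
      unfolding err_Suc[OF that] \<alpha>_def \<beta>_def \<gamma>_def
      by (intro order_trans[OF cnorm_triangle[OF nrm]] add_mono cnorm_le_induced_norm[OF nrm] lin)
  qed
  \<comment> \<open>Only blocks n + 1 \<ge> 1 occur, where \<open>v\<close> agrees with
    \<open>u\<close>; \<open>N \<ge> 1\<close> turns \<open>n \<le> N - 1\<close> into
    \<open>n < N\<close>.\<close>
  have e_le: "e k (n + 1) \<le> error_gf \<alpha> \<beta> \<gamma> k $ n * \<delta>" if "n \<le> N - 1" for k n
    using bound[of n k] that \<open>N \<ge> 1\<close> by (simp add: e_def err_def v_def)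
  show ?thesis
  proof (intro allI impI conjI; elim conjE)
    fix k n :: nat
    assume k: "k > 0" and n: "n \<le> N - 1"
    note le = e_le[OF n, of k]
    show "e k (n + 1) \<le> (\<alpha> ^ k / fact (k - 1)
        * (\<Sum>i | i + k \<le> n. (\<Prod>l = 1..k - 1. real (i + l)) * \<beta> ^ i)) * \<delta>" if "\<gamma> = 0"
      using le unfolding that error_gf_nth_c_0[OF k] .
    show "e k (n + 1) \<le> (if k \<le> n then (\<gamma> + \<alpha>) ^ k
        else \<gamma> ^ k * (\<Sum>i = 0..n. real (k choose i) * (\<alpha> / \<gamma>) ^ i)) * \<delta>"
      if "\<beta> = 0" "\<gamma> \<noteq> 0"
      using le unfolding that(1) error_gf_nth_b_0[OF that(2)] .
    show "e k (n + 1) \<le> (\<gamma> ^ k / fact (k - 1)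
        * (\<Sum>i = 0..n. (\<Prod>l = 1..k - 1. real (i + l)) * \<beta> ^ i)) * \<delta>" if "\<alpha> = 0"
      using le unfolding that error_gf_nth_a_0[OF k] .
    show "e k (n + 1) \<le> (\<gamma> ^ k * (\<Sum>i = 0..min n k. \<Sum>l = 0..n - i.
        real (k choose i) * real ((l + k - 1) choose l) * (\<alpha> / \<gamma>) ^ i * \<beta> ^ l)) * \<delta>"
      if "\<gamma> \<noteq> 0"
      using le unfolding error_gf_nth_c_nonzero[OF that] .
  qed
qed

end
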